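(* Let $\lambda\neq0$ be a real number and let $X=f_1e_1+f_2e_2+f_3e_3$ be an arbitrary vector field on $(H_3,g_1)$, where $f_1,f_2,f_3$ are smooth real functions of $(x,y,z)\in\mathbb{R}^3$. Then $X$ is a Ricci collineation if and only if there exist real constants $c_1,c_2,c_3,c_4$ such that $$\begin{cases} f_1(x,y,z)=\frac{c_1}{2\lambda}x^2-\frac{\lambda c_1}{2}y^2+c_2x-\lambda c_3y+c_4,\\ f_2(x,y,z)=\frac{c_1}{\lambda}x+c_2,\\ f_3(x,y,z)=c_1y+c_3.\end{cases}$$
   Context: The Heisenberg group $H_3$ is $\mathbb{R}^3$ with global coordinates $(x,y,z)$ and multiplication $(x,y,z)(\tilde x,\tilde y,\tilde z)=(x+\tilde x,y+\tilde y,z+\tilde z-x\tilde y)$. For $\lambda\neq0$, $g_1$ is the left-invariant Lorentzian metric $g_1=-\frac{1}{\lambda^2}dx^2+dy^2+(x\,dy+dz)^2$, with left-invariant orthonormal frame $e_1=\partial_z$, $e_2=\partial_y-x\partial_z$, $e_3=\lambda\partial_x$ ($e_3$ timelike). With $R(X,Y)=[\nabla_X,\nabla_Y]-\nabla_{[X,Y]}$ the curvature tensor of the Levi-Civita connection, the Ricci tensor is $\varrho(X,Y)=\sum_k g(e_k,e_k)\,g(R(e_k,X)Y,e_k)$ for an orthonormal basis $\{e_k\}$. A smooth vector field $X$ is a Ricci collineation if $\mathcal{L}_X\varrho=0$. *)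

theory Defs
  imports "HOL-Analysis.Analysis"
begin

section \<open>Smooth functions and vector fields on Euclidean space\<close>

primrec Ck :: "nat \<Rightarrow> ('a::euclidean_space \<Rightarrow> 'b::euclidean_space) \<Rightarrow> bool" where
  "Ck 0 f \<longleftrightarrow> continuous_on UNIV f"
| "Ck (Suc k) f \<longleftrightarrow> (\<forall>p. f differentiable (at p)) \<and>
     (\<forall>v. Ck k (\<lambda>p. frechet_derivative f (at p) v))"

definition smooth :: "('a::euclidean_space \<Rightarrow> 'b::euclidean_space) \<Rightarrow> bool" where
  "smooth f \<longleftrightarrow> (\<forall>k. Ck k f)"

type_synonym 'n scalar_field = "real^'n \<Rightarrow> real"

text \<open>A vector field is given by its components with respect to the global coordinate
  frame: \<open>X p $ i\<close> is the coefficient of the i-th coordinate vector field at \<open>p\<close>.\<close>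
type_synonym 'n vector_field = "real^'n \<Rightarrow> real^'n"

text \<open>A metric assigns to a point a bilinear form on the tangent space at that point.\<close>
type_synonym 'n metric = "real^'n \<Rightarrow> real^'n \<Rightarrow> real^'n \<Rightarrow> real"

type_synonym 'n connection = "'n vector_field \<Rightarrow> 'n vector_field \<Rightarrow> 'n vector_field"

type_synonym 'n tensor2 = "'n vector_field \<Rightarrow> 'n vector_field \<Rightarrow> 'n scalar_field"

definition smooth_vfs :: "('n::finite) vector_field set" where
  "smooth_vfs = {X. smooth X}"

definition apply_vf :: "('n::finite) vector_field \<Rightarrow> 'n scalar_field \<Rightarrow> 'n scalar_field" where
  "apply_vf X f = (\<lambda>p. frechet_derivative f (at p) (X p))"

definition lie_bracket :: "('n::finite) vector_field \<Rightarrow> 'n vector_field \<Rightarrow> 'n vector_field" where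
  "lie_bracket X Y =
     (\<lambda>p. frechet_derivative Y (at p) (X p) - frechet_derivative X (at p) (Y p))"

section \<open>Levi-Civita connection, curvature and Ricci tensor\<close>

text \<open>The extensional function space \<open>\<rightarrow>\<^sub>E\<close> fixes the values on non-smooth arguments
  to \<open>undefined\<close>; hence a connection is determined by its values on smooth fields, and
  the definite description in \<open>levi_civita\<close> below is meaningful.\<close>

definition affine_connection :: "('n::finite) connection \<Rightarrow> bool" where
  "affine_connection D \<longleftrightarrow>
     D \<in> smooth_vfs \<rightarrow>\<^sub>E smooth_vfs \<rightarrow>\<^sub>E smooth_vfs \<and>
     (\<forall>X\<in>smooth_vfs. \<forall>Y\<in>smooth_vfs. \<forall>Z\<in>smooth_vfs.
        D (\<lambda>p. X p + Y p) Z = (\<lambda>p. D X Z p + D Y Z p) \<and>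
        D X (\<lambda>p. Y p + Z p) = (\<lambda>p. D X Y p + D X Z p)) \<and>
     (\<forall>f. \<forall>X\<in>smooth_vfs. \<forall>Y\<in>smooth_vfs. smooth f \<longrightarrow>
        D (\<lambda>p. f p *\<^sub>R X p) Y = (\<lambda>p. f p *\<^sub>R D X Y p) \<and>
        D X (\<lambda>p. f p *\<^sub>R Y p) = (\<lambda>p. apply_vf X f p *\<^sub>R Y p + f p *\<^sub>R D X Y p))"

definition torsion_free :: "('n::finite) connection \<Rightarrow> bool" where
  "torsion_free D \<longleftrightarrow> (\<forall>X\<in>smooth_vfs. \<forall>Y\<in>smooth_vfs.
     (\<lambda>p. D X Y p - D Y X p) = lie_bracket X Y)"

definition metric_compatible :: "('n::finite) metric \<Rightarrow> 'n connection \<Rightarrow> bool" where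
  "metric_compatible g D \<longleftrightarrow> (\<forall>X\<in>smooth_vfs. \<forall>Y\<in>smooth_vfs. \<forall>Z\<in>smooth_vfs.
     apply_vf X (\<lambda>p. g p (Y p) (Z p)) = (\<lambda>p. g p (D X Y p) (Z p) + g p (Y p) (D X Z p)))"

definition levi_civita :: "('n::finite) metric \<Rightarrow> 'n connection" where
  "levi_civita g = (THE D. affine_connection D \<and> torsion_free D \<and> metric_compatible g D)"

definition curvature ::
    "('n::finite) metric \<Rightarrow> 'n vector_field \<Rightarrow> 'n vector_field \<Rightarrow> 'n vector_field \<Rightarrow> 'n vector_field" where
  "curvature g X Y Z = (let D = levi_civita g in
     (\<lambda>p. D X (D Y Z) p - D Y (D X Z) p - D (lie_bracket X Y) Z p))"

definition orthonormal_frame :: "('n::finite) metric \<Rightarrow> ('n \<Rightarrow> 'n vector_field) \<Rightarrow> bool" where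
  "orthonormal_frame g e \<longleftrightarrow> (\<forall>i. e i \<in> smooth_vfs) \<and>
     (\<forall>p i j. if i = j then \<bar>g p (e i p) (e i p)\<bar> = 1 else g p (e i p) (e j p) = 0)"

text \<open>The frame \<open>e\<close> is meant to be orthonormal; the result does not depend on its choice.\<close>
definition ricci :: "('n::finite) metric \<Rightarrow> ('n \<Rightarrow> 'n vector_field) \<Rightarrow> 'n tensor2" where
  "ricci g e X Y = (\<lambda>p. \<Sum>k\<in>UNIV.
     g p (e k p) (e k p) * g p (curvature g (e k) X Y p) (e k p))"

definition lie_derivative :: "('n::finite) vector_field \<Rightarrow> 'n tensor2 \<Rightarrow> 'n tensor2" where
  "lie_derivative X T Y Z =
     (\<lambda>p. apply_vf X (T Y Z) p - T (lie_bracket X Y) Z p - T Y (lie_bracket X Z) p)"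

definition ricci_collineation ::
    "('n::finite) metric \<Rightarrow> ('n \<Rightarrow> 'n vector_field) \<Rightarrow> 'n vector_field \<Rightarrow> bool" where
  "ricci_collineation g e X \<longleftrightarrow> X \<in> smooth_vfs \<and>
     (\<forall>Y\<in>smooth_vfs. \<forall>Z\<in>smooth_vfs. lie_derivative X (ricci g e) Y Z = (\<lambda>p. 0))"

section \<open>The Heisenberg group with its Lorentzian metric\<close>

text \<open>The coordinates of \<open>p\<close> are \<open>x = p $ 1\<close>, \<open>y = p $ 2\<close>, \<open>z = p $ 3\<close>.\<close>

definition heis_mult :: "real^3 \<Rightarrow> real^3 \<Rightarrow> real^3" where
  "heis_mult p q = vector [p$1 + q$1, p$2 + q$2, p$3 + q$3 - p$1 * q$2]"

definition heis_g1 :: "real \<Rightarrow> 3 metric" where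
  "heis_g1 lam p u v = - (1 / lam\<^sup>2) * (u$1 * v$1) + u$2 * v$2
     + (p$1 * u$2 + u$3) * (p$1 * v$2 + v$3)"

definition heis_frame :: "real \<Rightarrow> 3 \<Rightarrow> 3 vector_field" where
  "heis_frame lam k = (\<lambda>p.
     if k = 1 then vector [0, 0, 1]
     else if k = 2 then vector [0, 1, - p$1]
     else vector [lam, 0, 0])"

lemma heis_mult_has_derivative:
  "(heis_mult a has_derivative (\<lambda>u. vector [u$1, u$2, u$3 - a$1 * u$2])) (at p)"
proof -
  have aux: "((\<lambda>q. heis_mult a q $ i) has_derivative
      (\<lambda>u. (vector [u$1, u$2, u$3 - a$1 * u$2] :: real^3) $ i)) (at p)" for i :: 3
    using exhaust_3[of i] unfolding heis_mult_def
    by (elim disjE) (auto intro!: derivative_eq_intros bounded_linear.has_derivative[OF bounded_linear_vec_nth])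
  show ?thesis
    unfolding has_derivative_componentwise_within[of "heis_mult a"]
    using aux by (auto simp: Basis_vec_def inner_axis)
qed

lemma heis_g1_left_invariant:
  "heis_g1 lam (heis_mult a p)
     (frechet_derivative (heis_mult a) (at p) u) (frechet_derivative (heis_mult a) (at p) v)
   = heis_g1 lam p u v"
  unfolding frechet_derivative_at[OF heis_mult_has_derivative, symmetric]
  by (simp add: heis_g1_def heis_mult_def algebra_simps)

lemma heis_frame_left_invariant:
  "frechet_derivative (heis_mult a) (at p) (heis_frame lam k p) = heis_frame lam k (heis_mult a p)"
  unfolding frechet_derivative_at[OF heis_mult_has_derivative, symmetric]
  by (simp add: heis_frame_def heis_mult_def vec_eq_iff forall_3)

lemma Ck_const: "Ck k (\<lambda>p. c)"
  by (induction k arbitrary: c) simp_all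

lemma Ck_affine:
  assumes "bounded_linear L"
  shows "Ck k (\<lambda>p. L p + c)"
proof (cases k)
  case 0
  then show ?thesis
    using continuous_on_add[OF linear_continuous_on[OF assms] continuous_on_const] by simp
next
  case (Suc n)
  have "((\<lambda>p. L p + c) has_derivative L) (at p)" for p
    using has_derivative_add_const[OF bounded_linear_imp_has_derivative[OF assms]] .
  note d = this
  have "frechet_derivative (\<lambda>p. L p + c) (at p) = L" for p
    using frechet_derivative_at[OF d] by simp
  then show ?thesis
    using Suc differentiableI[OF d] by (simp add: Ck_const)
qed

lemma heis_frame_smooth: "heis_frame lam k \<in> smooth_vfs"
proof -
  have lin: "linear (\<lambda>p::real^3. if k = 2 then vector [0, 0, - p$1] else 0 :: real^3)" (is "linear ?L")
    by (rule linearI) (auto simp: vec_eq_iff forall_3)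
  have eq: "heis_frame lam k = (\<lambda>p. ?L p + heis_frame lam k 0)"
    by (auto simp: heis_frame_def vec_eq_iff forall_3 fun_eq_iff)
  have "Ck n (\<lambda>p. ?L p + heis_frame lam k 0)" for n
    by (rule Ck_affine) (use lin linear_linear in blast)
  then show ?thesis
    unfolding smooth_vfs_def smooth_def by (subst eq) simp
qed

lemma heis_frame_orthonormal:
  assumes "lam \<noteq> 0"
  shows "orthonormal_frame (heis_g1 lam) (heis_frame lam)"
    and "heis_g1 lam p (heis_frame lam 1 p) (heis_frame lam 1 p) = 1"
    and "heis_g1 lam p (heis_frame lam 2 p) (heis_frame lam 2 p) = 1"
    and "heis_g1 lam p (heis_frame lam 3 p) (heis_frame lam 3 p) = -1"
proof -
  have *: "heis_g1 lam p (heis_frame lam i p) (heis_frame lam j p) =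
      (if i = j then if i = 3 then -1 else 1 else 0)" for p i j
    using exhaust_3[of i] exhaust_3[of j] assms
    by (elim disjE) (simp_all add: heis_g1_def heis_frame_def power2_eq_square)
  show "orthonormal_frame (heis_g1 lam) (heis_frame lam)"
    using heis_frame_smooth by (simp add: orthonormal_frame_def *)
  show "heis_g1 lam p (heis_frame lam 1 p) (heis_frame lam 1 p) = 1"
    "heis_g1 lam p (heis_frame lam 2 p) (heis_frame lam 2 p) = 1"
    "heis_g1 lam p (heis_frame lam 3 p) (heis_frame lam 3 p) = -1"
    by (simp_all add: *)
qed

end

theory Submission
  imports Defs
begin

text \<open>
  In the frame the Ricci tensor of \<open>g\<^sub>1\<close> is the constant diagonal form
  \<open>(lam\<^sup>2/2) diag(-1, 1, -1)\<close>, so \<open>X\<close> is a Ricci collineation iff the frame derivatives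
  \<open>E\<^sub>i f\<^sub>j\<close> satisfy six linear first-order equations. Set \<open>u = E\<^sub>1 f\<^sub>2\<close> and \<open>v = E\<^sub>1 f\<^sub>3\<close>.
  Applying the commutators \<open>[E\<^sub>1, E\<^sub>2] = [E\<^sub>1, E\<^sub>3] = 0\<close> and \<open>[E\<^sub>2, E\<^sub>3] = lam E\<^sub>1\<close> to these equations
  gives \<open>E\<^sub>1 u = lam v\<close>, \<open>E\<^sub>1 v = lam u\<close> and \<open>E\<^sub>2 u = E\<^sub>3 u = E\<^sub>2 v = E\<^sub>3 v = 0\<close>; hence
  \<open>lam E\<^sub>1 u = [E\<^sub>2, E\<^sub>3] u = 0\<close>, likewise for \<open>v\<close>, and so \<open>u = v = 0\<close>. Then
  \<open>E\<^sub>3 f\<^sub>2 = E\<^sub>2 f\<^sub>3\<close> is a constant \<open>c\<^sub>1\<close>, and all frame derivatives of the \<open>f\<^sub>i\<close> are known.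
\<close>

section \<open>Calculus of smooth maps\<close>

abbreviation dd :: "('a::euclidean_space \<Rightarrow> 'b::euclidean_space) \<Rightarrow> 'a \<Rightarrow> 'a \<Rightarrow> 'b" where
  "dd f p \<equiv> frechet_derivative f (at p)"

lemma dd_eqI: "(f has_derivative f') (at p) \<Longrightarrow> dd f p = f'"
  using frechet_derivative_at by metis

text \<open>At order 0, continuity comes from differentiability; higher up the induction hypothesis
  is applied to the directional derivatives, hence the generalisation over \<open>f\<close>.\<close>

lemma Ck_SucD: "Ck (Suc k) f \<Longrightarrow> Ck k f"
proof (induction k arbitrary: f)
  case 0
  then show ?case
    by (auto intro!: continuous_at_imp_continuous_on differentiable_imp_continuous_within)
next
  case (Suc k)
  have "Ck k (\<lambda>p. dd f p v)" for v
    using Suc.prems by (intro Suc.IH) (simp only: Ck.simps(2)[of "Suc k" f])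
  then show ?case
    using Suc.prems Ck.simps(2)[of "Suc k" f] Ck.simps(2)[of k f] by blast
qed

text \<open>Trades \<open>frechet_derivative\<close> for an explicitly computed \<open>f' p\<close>,
  so that inductions on \<open>k\<close> can use the differentiation rules.\<close>

lemma Ck_SucI:
  assumes "\<And>p. (f has_derivative f' p) (at p)" and "\<And>v. Ck k (\<lambda>p. f' p v)"
  shows "Ck (Suc k) f"
  using assms by (auto simp: dd_eqI[OF assms(1)] intro: differentiableI)

lemma Ck_has_derivative: "Ck (Suc k) f \<Longrightarrow> (f has_derivative dd f p) (at p)"
  using frechet_derivative_works by auto

lemma Ck_dd: "Ck (Suc k) f \<Longrightarrow> Ck k (\<lambda>p. dd f p v)"
  by simp

lemma Ck_add: "Ck k f \<Longrightarrow> Ck k g \<Longrightarrow> Ck k (\<lambda>p. f p + g p)"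
proof (induction k arbitrary: f g)
  case 0
  then show ?case by (simp add: continuous_on_add)
next
  case (Suc k)
  show ?case
    by (rule Ck_SucI[OF has_derivative_add[OF Ck_has_derivative[OF Suc.prems(1)]
            Ck_has_derivative[OF Suc.prems(2)]]])
      (intro Suc.IH Ck_dd Suc.prems)
qed

text \<open>The product rule gives two products with one factor differentiated;
  \<open>Ck_SucD\<close> lowers the order of the other factor to match.\<close>

lemma Ck_bilinear:
  assumes "bounded_bilinear B" "Ck k f" "Ck k g"
  shows "Ck k (\<lambda>p. B (f p) (g p))"
  using assms(2,3)
proof (induction k arbitrary: f g)
  case 0
  then show ?case
    using bounded_bilinear.continuous_on[OF assms(1)] by simp
next
  case (Suc k)
  show ?case
    by (rule Ck_SucI[OF bounded_bilinear.FDERIV[OF assms(1) Ck_has_derivative[OF Suc.prems(1)]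
            Ck_has_derivative[OF Suc.prems(2)]]])
      (intro Ck_add Suc.IH Ck_dd[where k = k] Suc.prems Ck_SucD)
qed

section \<open>Closure properties of smooth maps\<close>

lemma smooth_has_derivative: "smooth f \<Longrightarrow> (f has_derivative dd f p) (at p)"
  unfolding smooth_def using Ck_has_derivative by blast

lemma smooth_dd: "smooth f \<Longrightarrow> smooth (\<lambda>p. dd f p v)"
  unfolding smooth_def using Ck_dd by blast

lemma linear_dd: "smooth f \<Longrightarrow> linear (dd f p)"
  using smooth_has_derivative has_derivative_linear by blast

lemma smooth_const [simp]: "smooth (\<lambda>p. c)"
  by (simp add: smooth_def Ck_const)

lemma smooth_bounded_linear:
  assumes "bounded_linear L"
  shows "smooth L"
  using Ck_affine[OF assms, of _ 0] by (simp add: smooth_def)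

lemma smooth_add: "smooth f \<Longrightarrow> smooth g \<Longrightarrow> smooth (\<lambda>p. f p + g p)"
  by (simp add: smooth_def Ck_add)

lemma smooth_bilinear:
  "bounded_bilinear B \<Longrightarrow> smooth f \<Longrightarrow> smooth g \<Longrightarrow> smooth (\<lambda>p. B (f p) (g p))"
  by (simp add: smooth_def Ck_bilinear)

lemma smooth_scaleR: "smooth f \<Longrightarrow> smooth g \<Longrightarrow> smooth (\<lambda>p. f p *\<^sub>R g p)"
  by (rule smooth_bilinear[OF bounded_bilinear_scaleR])

lemma smooth_inner: "smooth f \<Longrightarrow> smooth g \<Longrightarrow> smooth (\<lambda>p. f p \<bullet> g p)"
  by (rule smooth_bilinear[OF bounded_bilinear_inner])

lemma smooth_mult:
  fixes f g :: "'a::euclidean_space \<Rightarrow> real"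
  shows "smooth f \<Longrightarrow> smooth g \<Longrightarrow> smooth (\<lambda>p. f p * g p)"
  by (rule smooth_bilinear[OF bounded_bilinear_mult])

lemma smooth_uminus:
  assumes "smooth f" shows "smooth (\<lambda>p. - f p)"
  using smooth_scaleR[OF smooth_const[of "-1"] assms] by simp

lemma smooth_diff: "smooth f \<Longrightarrow> smooth g \<Longrightarrow> smooth (\<lambda>p. f p - g p)"
  using smooth_add[of f "\<lambda>p. - g p"] smooth_uminus[of g] by simp

lemma smooth_sum: "(\<And>i. i \<in> I \<Longrightarrow> smooth (f i)) \<Longrightarrow> smooth (\<lambda>p. \<Sum>i\<in>I. f i p)"
  by (induction I rule: infinite_finite_induct) (auto intro: smooth_add)

lemma smooth_coord: "smooth (\<lambda>p::real^'n. p $ i)"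
  by (rule smooth_bounded_linear) (rule bounded_linear_vec_nth)

lemma smooth_vecI:
  fixes X :: "'a::euclidean_space \<Rightarrow> real^'n"
  assumes "\<And>i. smooth (\<lambda>p. X p $ i)"
  shows "smooth X"
proof -
  have "X = (\<lambda>p. \<Sum>i\<in>UNIV. X p $ i *\<^sub>R axis i 1)" (is "_ = ?Y")
    by (simp only: scalar_mult_eq_scaleR[symmetric] basis_expansion)
  have "smooth ?Y"
    by (intro smooth_sum smooth_scaleR assms smooth_const)
  then show ?thesis
    by (simp only: \<open>X = ?Y\<close>[symmetric])
qed

text \<open>Schwarz's theorem: both iterated derivatives are, up to small errors, the second
  difference quotient of \<open>f\<close>.\<close>

lemma second_difference_mean_value:
  fixes f :: "'a::euclidean_space \<Rightarrow> real"
  assumes "smooth f" "t > 0"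
  shows "\<exists>q. dist q p \<le> t * (norm u + norm v) \<and>
    f (p + t *\<^sub>R u + t *\<^sub>R v) - f (p + t *\<^sub>R u) - f (p + t *\<^sub>R v) + f p
      = t\<^sup>2 * dd (\<lambda>q. dd f q u) q v"
proof -
  \<comment> \<open>Chain rule along a line, relative to any set \<open>S\<close> because
    \<open>mvt_simple\<close> asks for derivatives within an interval.\<close>
  have line: "((\<lambda>s. h (a + s *\<^sub>R w)) has_derivative (\<lambda>s. s * dd h (a + r *\<^sub>R w) w)) (at r within S)"
    if "smooth h" for h :: "'a \<Rightarrow> real" and a w r S
  proof -
    interpret linear "dd h (a + r *\<^sub>R w)" using linear_dd[OF that] .
    have "((\<lambda>s. h (a + s *\<^sub>R w)) has_derivative (\<lambda>s. dd h (a + r *\<^sub>R w) (s *\<^sub>R w))) (at r)"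
      by (rule has_derivative_compose[of "\<lambda>s. a + s *\<^sub>R w", OF _ smooth_has_derivative[OF that]])
        (auto intro!: derivative_eq_intros)
    then show ?thesis by (simp add: scale has_derivative_at_withinI)
  qed
  \<comment> \<open>The increment in direction \<open>v\<close> as a function of the shift along
    \<open>u\<close>. The second difference is \<open>?\<phi> t - ?\<phi> 0\<close>; the mean value
    theorem is applied along \<open>u\<close>, then along \<open>v\<close>.\<close>
  let ?\<phi> = "\<lambda>s. f ((p + t *\<^sub>R v) + s *\<^sub>R u) - f (p + s *\<^sub>R u)"
  let ?\<phi>' = "\<lambda>r s. s * dd f ((p + t *\<^sub>R v) + r *\<^sub>R u) u - s * dd f (p + r *\<^sub>R u) u"
  have "\<exists>r\<in>{0<..<t}. ?\<phi> t - ?\<phi> 0 = ?\<phi>' r (t - 0)"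
    by (rule mvt_simple[OF assms(2)]) (intro has_derivative_diff line assms)
  then obtain r where r: "0 < r" "r < t" "?\<phi> t - ?\<phi> 0 = ?\<phi>' r t"
    by auto
  let ?\<psi> = "\<lambda>s. dd f (p + r *\<^sub>R u + s *\<^sub>R v) u"
  have "\<exists>s\<in>{0<..<t}. ?\<psi> t - ?\<psi> 0 = (t - 0) * dd (\<lambda>q. dd f q u) (p + r *\<^sub>R u + s *\<^sub>R v) v"
    by (rule mvt_simple[OF assms(2)]) (intro line smooth_dd assms)
  then obtain s where s: "0 < s" "s < t"
      "?\<psi> t - ?\<psi> 0 = t * dd (\<lambda>q. dd f q u) (p + r *\<^sub>R u + s *\<^sub>R v) v"
    by auto
  have "norm (r *\<^sub>R u + s *\<^sub>R v) \<le> norm (r *\<^sub>R u) + norm (s *\<^sub>R v)"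
    by (rule norm_triangle_ineq)
  also have "\<dots> \<le> t * (norm u + norm v)"
    using r s by (simp add: distrib_left add_mono mult_right_mono)
  finally have "dist (p + r *\<^sub>R u + s *\<^sub>R v) p \<le> t * (norm u + norm v)"
    by (simp add: dist_norm add.assoc)
  moreover have "f (p + t *\<^sub>R u + t *\<^sub>R v) - f (p + t *\<^sub>R u) - f (p + t *\<^sub>R v) + f p
      = t * (?\<psi> t - ?\<psi> 0)"
    using r(3) by (simp add: algebra_simps)
  ultimately show ?thesis
    by (intro exI[of _ "p + r *\<^sub>R u + s *\<^sub>R v"] conjI) (simp_all only: s(3) power2_eq_square mult.assoc)
qed

lemma smooth_continuous: "smooth f \<Longrightarrow> isCont f p"
  using smooth_has_derivative has_derivative_continuous by blast

lemma second_derivative_commute_real: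
  fixes f :: "'a::euclidean_space \<Rightarrow> real"
  assumes f: "smooth f"
  shows "dd (\<lambda>q. dd f q u) p v = dd (\<lambda>q. dd f q v) p u"
proof -
  define N where "N = norm u + norm v"
  \<comment> \<open>With step \<open>1 / Suc n\<close>, both orders of \<open>u\<close> and
    \<open>v\<close> give the same second difference, so the two mixed derivatives agree at nearby
    points \<open>a\<close> and \<open>b\<close>. Both tend to \<open>p\<close>, and continuity
    finishes.\<close>
  have "\<forall>n. \<exists>a b. dist a p \<le> N / Suc n \<and> dist b p \<le> N / Suc n \<and>
      dd (\<lambda>q. dd f q u) a v = dd (\<lambda>q. dd f q v) b u"
  proof
    fix n
    define t where "t = 1 / real (Suc n)"
    have t: "t > 0" by (simp add: t_def)
    obtain a where a: "dist a p \<le> t * (norm u + norm v)"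
      "f (p + t *\<^sub>R u + t *\<^sub>R v) - f (p + t *\<^sub>R u) - f (p + t *\<^sub>R v) + f p
      = t\<^sup>2 * dd (\<lambda>q. dd f q u) a v"
      using second_difference_mean_value[OF f t] by blast
    obtain b where b: "dist b p \<le> t * (norm v + norm u)"
      "f (p + t *\<^sub>R v + t *\<^sub>R u) - f (p + t *\<^sub>R v) - f (p + t *\<^sub>R u) + f p
      = t\<^sup>2 * dd (\<lambda>q. dd f q v) b u"
      using second_difference_mean_value[OF f t] by blast
    have "t\<^sup>2 * dd (\<lambda>q. dd f q u) a v = t\<^sup>2 * dd (\<lambda>q. dd f q v) b u"
      unfolding a(2)[symmetric] b(2)[symmetric] by (simp add: algebra_simps)
    then show "\<exists>a b. dist a p \<le> N / Suc n \<and> dist b p \<le> N / Suc n \<and>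
      dd (\<lambda>q. dd f q u) a v = dd (\<lambda>q. dd f q v) b u"
      using a(1) b(1) t by (intro exI[of _ a] exI[of _ b]) (simp add: t_def N_def add.commute)
  qed
  then obtain a b where ab: "\<And>n. dist (a n) p \<le> N / Suc n" "\<And>n. dist (b n) p \<le> N / Suc n"
      "\<And>n. dd (\<lambda>q. dd f q u) (a n) v = dd (\<lambda>q. dd f q v) (b n) u"
    by metis
  have "(\<lambda>n. N / Suc n) \<longlonglongrightarrow> 0"
    using LIMSEQ_Suc[OF lim_const_over_n[of N]] by simp
  then have "c \<longlonglongrightarrow> p" if "\<And>n. dist (c n) p \<le> N / Suc n" for c
    unfolding tendsto_dist_iff[of c]
    by (rule Lim_null_comparison[OF always_eventually, rotated]) (use that in simp)
  then have a: "a \<longlonglongrightarrow> p" and b: "b \<longlonglongrightarrow> p"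
    using ab(1,2) by auto
  have lim: "(\<lambda>n. dd (\<lambda>q. dd f q w) (c n) w') \<longlonglongrightarrow> dd (\<lambda>q. dd f q w) p w'"
    if "c \<longlonglongrightarrow> p" for c w w'
    using isCont_tendsto_compose[OF smooth_continuous[OF smooth_dd[OF smooth_dd[OF f]]] that] .
  show ?thesis
    using LIMSEQ_unique[OF lim[OF a, of u v]] lim[OF b, of v u]
    unfolding ab(3) by blast
qed

lemma dd_inner_const:
  assumes "smooth f"
  shows "dd (\<lambda>q. f q \<bullet> b) p h = dd f p h \<bullet> b"
  using dd_eqI[OF has_derivative_inner_left[OF smooth_has_derivative[OF assms]]] by simp

text \<open>Inner products with basis vectors reduce this to the real-valued case, where the mean
  value theorem applies.\<close>

lemma second_derivative_commute:
  assumes f: "smooth f"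
  shows "dd (\<lambda>q. dd f q u) p v = dd (\<lambda>q. dd f q v) p u"
proof (rule euclidean_eqI)
  fix b
  have "dd (\<lambda>q. dd (\<lambda>q. f q \<bullet> b) q u) p v = dd (\<lambda>q. dd (\<lambda>q. f q \<bullet> b) q v) p u"
    by (intro second_derivative_commute_real smooth_inner f smooth_const)
  then show "dd (\<lambda>q. dd f q u) p v \<bullet> b = dd (\<lambda>q. dd f q v) p u \<bullet> b"
    by (simp add: dd_inner_const f smooth_dd)
qed

section \<open>Families of linear and bilinear maps depending smoothly on the point\<close>

lemma linear_family_expand:
  assumes "linear L"
  shows "L v = (\<Sum>b\<in>Basis. (v \<bullet> b) *\<^sub>R L b)"
proof -
  have "L v = L (\<Sum>b\<in>Basis. (v \<bullet> b) *\<^sub>R b)"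
    by (simp only: euclidean_representation)
  then show ?thesis
    by (simp only: linear_sum[OF assms] linear_scale[OF assms])
qed

lemma smooth_linear_family:
  assumes "\<And>p. linear (L p)" "\<And>v. smooth (\<lambda>p. L p v)" "smooth Y"
  shows "smooth (\<lambda>p. L p (Y p))"
proof -
  have "smooth (\<lambda>p. \<Sum>b\<in>Basis. (Y p \<bullet> b) *\<^sub>R L p b)"
    by (intro smooth_sum smooth_scaleR smooth_inner assms smooth_const)
  then show ?thesis
    by (simp only: linear_family_expand[OF assms(1), symmetric])
qed

text \<open>Product rule for a moving map at a moving argument, obtained by expanding the argument
  in the basis.\<close>

lemma dd_linear_family:
  assumes L: "\<And>p. linear (L p)" "\<And>v. smooth (\<lambda>p. L p v)" and Y: "smooth Y"
  shows "dd (\<lambda>p. L p (Y p)) p h = dd (\<lambda>q. L q (Y p)) p h + L p (dd Y p h)"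
proof -
  \<comment> \<open>Stated for all smooth \<open>Z\<close>: it is used for \<open>Y\<close> and for
    the constant field \<open>Y p\<close>, which identifies the first partial sum.\<close>
  have 1: "dd (\<lambda>q. L q (Z q)) p
      = (\<lambda>h. \<Sum>b\<in>Basis. (Z p \<bullet> b) *\<^sub>R dd (\<lambda>q. L q b) p h + (dd Z p h \<bullet> b) *\<^sub>R L p b)"
    if "smooth Z" for Z
  proof -
    have "((\<lambda>q. \<Sum>b\<in>Basis. (Z q \<bullet> b) *\<^sub>R L q b) has_derivative
     (\<lambda>h. \<Sum>b\<in>Basis. (Z p \<bullet> b) *\<^sub>R dd (\<lambda>q. L q b) p h + (dd Z p h \<bullet> b) *\<^sub>R L p b)) (at p)"
      by (intro has_derivative_sum has_derivative_scaleR has_derivative_inner_left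
        smooth_has_derivative L(2) that)
    then show ?thesis
      by (intro dd_eqI) (simp only: linear_family_expand[OF L(1), symmetric])
  qed
  have "dd (\<lambda>p. L p (Y p)) p h
     = (\<Sum>b\<in>Basis. (Y p \<bullet> b) *\<^sub>R dd (\<lambda>q. L q b) p h) + (\<Sum>b\<in>Basis. (dd Y p h \<bullet> b) *\<^sub>R L p b)"
    unfolding 1[OF Y] by (rule sum.distrib)
  also have "(\<Sum>b\<in>Basis. (Y p \<bullet> b) *\<^sub>R dd (\<lambda>q. L q b) p h) = dd (\<lambda>q. L q (Y p)) p h"
    using 1[OF smooth_const, of "Y p"] by simp
  also have "(\<Sum>b\<in>Basis. (dd Y p h \<bullet> b) *\<^sub>R L p b) = L p (dd Y p h)"
    by (rule linear_family_expand[OF L(1), symmetric])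
  finally show ?thesis .
qed

lemma smooth_dd_field:
  assumes "smooth f" "smooth X"
  shows "smooth (\<lambda>p. dd f p (X p))"
  using smooth_linear_family[OF linear_dd[OF assms(1)] smooth_dd[OF assms(1)] assms(2)] .

lemma dd_dd_field:
  assumes "smooth f" "smooth X"
  shows "dd (\<lambda>p. dd f p (X p)) p h = dd (\<lambda>q. dd f q (X p)) p h + dd f p (dd X p h)"
  using dd_linear_family[OF linear_dd[OF assms(1)] smooth_dd[OF assms(1)] assms(2)] .

text \<open>Common notion for the metric, the Christoffel symbols and the Ricci form; smoothness is
  required on constant vectors, where it can be read off the coefficients.\<close>

definition bilinear_field ::
    "('a::euclidean_space \<Rightarrow> 'a \<Rightarrow> 'a \<Rightarrow> 'b::euclidean_space) \<Rightarrow> bool" where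
  "bilinear_field B \<longleftrightarrow> (\<forall>p. bilinear (B p)) \<and> (\<forall>u v. smooth (\<lambda>p. B p u v))"

lemma
  assumes B: "bilinear_field B" and X: "smooth X" and Y: "smooth Y"
  shows smooth_bilinear_field: "smooth (\<lambda>p. B p (X p) (Y p))"
    and dd_bilinear_field: "dd (\<lambda>p. B p (X p) (Y p)) p h
      = dd (\<lambda>q. B q (X p) (Y p)) p h + B p (dd X p h) (Y p) + B p (X p) (dd Y p h)"
proof -
  have B1: "linear (\<lambda>u. B p u v)" and B2: "linear (B p u)" and B3: "smooth (\<lambda>p. B p u v)" for p u v
    using B by (auto simp: bilinear_field_def bilinear_def)
  have s: "smooth (\<lambda>p. B p u (Y p))" for u
    using smooth_linear_family[OF B2 B3 Y] .
  show "smooth (\<lambda>p. B p (X p) (Y p))"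
    using smooth_linear_family[of "\<lambda>p u. B p u (Y p)", OF B1 s X] .
  show "dd (\<lambda>p. B p (X p) (Y p)) p h
      = dd (\<lambda>q. B q (X p) (Y p)) p h + B p (dd X p h) (Y p) + B p (X p) (dd Y p h)"
    using dd_linear_family[of "\<lambda>p u. B p u (Y p)", OF B1 s X, of p h]
      dd_linear_family[OF B2 B3 Y, of "X p" p h]
    by simp
qed

section \<open>Connections given by Christoffel symbols\<close>

text \<open>The restricted abstractions give \<open>undefined\<close> off the smooth fields, as the
  extensional function space in \<open>affine_connection\<close> demands.\<close>

definition christoffel_connection ::
    "(real^'n \<Rightarrow> real^'n \<Rightarrow> real^'n \<Rightarrow> real^'n) \<Rightarrow> ('n::finite) connection" where
  "christoffel_connection G = (\<lambda>X\<in>smooth_vfs. \<lambda>Y\<in>smooth_vfs.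
     \<lambda>p. dd Y p (X p) + G p (X p) (Y p))"

lemma smooth_christoffel:
  assumes "bilinear_field G" "smooth X" "smooth Y"
  shows "smooth (\<lambda>p. dd Y p (X p) + G p (X p) (Y p))"
  using smooth_add[OF smooth_dd_field[OF assms(3,2)] smooth_bilinear_field[OF assms]] .

lemma christoffel_connection_apply:
  "smooth X \<Longrightarrow> smooth Y \<Longrightarrow>
    christoffel_connection G X Y = (\<lambda>p. dd Y p (X p) + G p (X p) (Y p))"
  by (simp add: christoffel_connection_def smooth_vfs_def)

lemma dd_add: "smooth f \<Longrightarrow> smooth g \<Longrightarrow> dd (\<lambda>p. f p + g p) p h = dd f p h + dd g p h"
  by (simp add: dd_eqI[OF has_derivative_add[OF smooth_has_derivative smooth_has_derivative]])

lemma dd_scaleR: "smooth f \<Longrightarrow> smooth X \<Longrightarrow>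
    dd (\<lambda>p. f p *\<^sub>R X p) p h = f p *\<^sub>R dd X p h + dd f p h *\<^sub>R X p"
  by (simp add: dd_eqI[OF has_derivative_scaleR[OF smooth_has_derivative smooth_has_derivative]])

lemma affine_christoffel_connection:
  assumes G: "bilinear_field G"
  shows "affine_connection (christoffel_connection G)"
proof -
  have "bilinear (G p)" for p
    using G by (simp add: bilinear_field_def)
  note lin = this[THEN bilinear_ladd] this[THEN bilinear_radd] this[THEN bilinear_lmul]
    this[THEN bilinear_rmul]
  have "christoffel_connection G \<in> smooth_vfs \<rightarrow>\<^sub>E smooth_vfs \<rightarrow>\<^sub>E smooth_vfs"
    using smooth_christoffel[OF G]
    by (auto simp: christoffel_connection_def smooth_vfs_def)
  then show ?thesis
    unfolding affine_connection_def smooth_vfs_def mem_Collect_eq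
    by (intro conjI ballI allI impI)
      (simp_all add: smooth_vfs_def christoffel_connection_apply smooth_add
        smooth_scaleR lin dd_add dd_scaleR linear_add[OF linear_dd] linear_scale[OF linear_dd]
        apply_vf_def scaleR_add_right add_ac)
qed

text \<open>For two Levi-Civita connections, \<open>g (D X Y - D' X Y) Z\<close> is symmetric in \<open>X, Y\<close> and skew in
  \<open>Y, Z\<close>, hence zero.\<close>

lemma levi_civita_unique:
  fixes g :: "('n::finite) metric"
  assumes g_sym: "\<And>p u v. g p u v = g p v u" and bil: "\<And>p. bilinear (g p)"
    and nondeg: "\<And>p u. \<forall>v. g p u v = 0 \<Longrightarrow> u = 0"
    and D: "affine_connection D" "torsion_free D" "metric_compatible g D"
    and D': "affine_connection D'" "torsion_free D'" "metric_compatible g D'"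
  shows "D = D'"
proof -
  have ext: "D \<in> smooth_vfs \<rightarrow>\<^sub>E smooth_vfs \<rightarrow>\<^sub>E smooth_vfs"
    "D' \<in> smooth_vfs \<rightarrow>\<^sub>E smooth_vfs \<rightarrow>\<^sub>E smooth_vfs"
    using D(1) D'(1) by (simp_all add: affine_connection_def)
  define S where "S = (\<lambda>X Y p. D X Y p - D' X Y p)"
  have tor: "S X Y p = S Y X p" if "X \<in> smooth_vfs" "Y \<in> smooth_vfs" for X Y p
  proof -
    have "(\<lambda>p. D X Y p - D Y X p) = (\<lambda>p. D' X Y p - D' Y X p)"
      using D(2) D'(2) that by (simp add: torsion_free_def)
    then have "D X Y p - D Y X p = D' X Y p - D' Y X p"
      by (rule fun_cong)
    then show ?thesis
      by (simp add: S_def algebra_simps)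
  qed
  have skew: "g p (S X Y p) (Z p) = - g p (S X Z p) (Y p)"
    if "X \<in> smooth_vfs" "Y \<in> smooth_vfs" "Z \<in> smooth_vfs" for X Y Z p
  proof -
    have "(\<lambda>p. g p (D X Y p) (Z p) + g p (Y p) (D X Z p))
        = (\<lambda>p. g p (D' X Y p) (Z p) + g p (Y p) (D' X Z p))"
      using D(3)[unfolded metric_compatible_def, rule_format, OF that]
        D'(3)[unfolded metric_compatible_def, rule_format, OF that] by (rule trans[OF sym])
    then have "g p (D X Y p) (Z p) + g p (Y p) (D X Z p)
        = g p (D' X Y p) (Z p) + g p (Y p) (D' X Z p)"
      by (rule fun_cong)
    then show ?thesis
      by (simp add: S_def bilinear_lsub[OF bil] g_sym[of p "Y p"])
  qed
  have "S X Y p = 0" if XY: "X \<in> smooth_vfs" "Y \<in> smooth_vfs" for X Y p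
  proof (rule nondeg, rule allI)
    fix w :: "real^'n"
    \<comment> \<open>The constant field extends the tangent vector \<open>w\<close>, so
      nondegeneracy can be tested at \<open>p\<close>.\<close>
    define Z where "Z = (\<lambda>p::real^'n. w)"
    have Z: "Z \<in> smooth_vfs"
      by (simp add: smooth_vfs_def Z_def)
    \<comment> \<open>Three skew swaps alternating with three symmetric ones return to the initial
      term with the opposite sign.\<close>
    have "g p (S X Y p) (Z p) = 0"
      using skew[OF XY Z, of p] skew[OF Z XY, of p] skew[OF XY(2) Z XY(1), of p]
        tor[OF XY, of p] tor[OF XY(1) Z, of p] tor[OF XY(2) Z, of p]
      by simp
    then show "g p (S X Y p) w = 0"
      by (simp add: Z_def)
  qed
  then have "D X Y = D' X Y" if "X \<in> smooth_vfs" "Y \<in> smooth_vfs" for X Y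
    using that by (simp add: S_def fun_eq_iff)
  moreover have "D X \<in> smooth_vfs \<rightarrow>\<^sub>E smooth_vfs" "D' X \<in> smooth_vfs \<rightarrow>\<^sub>E smooth_vfs"
    if "X \<in> smooth_vfs" for X
    using ext that by (auto dest: PiE_mem)
  ultimately have "D X = D' X" if "X \<in> smooth_vfs" for X
    using that by (intro PiE_ext[of "D X" smooth_vfs "\<lambda>_. smooth_vfs"]) blast+
  then show ?thesis
    using ext by (intro PiE_ext[of D smooth_vfs "\<lambda>_. smooth_vfs \<rightarrow>\<^sub>E smooth_vfs"]) blast+
qed

text \<open>By uniqueness it suffices to verify a candidate: symmetry of \<open>G\<close> kills the
  torsion, and \<open>compat\<close>, given on constant vectors, extends to fields by the product
  rule.\<close>

lemma levi_civita_christoffel: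
  fixes g :: "('n::finite) metric"
  assumes g_sym: "\<And>p u v. g p u v = g p v u" and g: "bilinear_field g"
    and nondeg: "\<And>p u. \<forall>v. g p u v = 0 \<Longrightarrow> u = 0"
    and G: "bilinear_field G" and G_sym: "\<And>p u v. G p u v = G p v u"
    and compat: "\<And>p u v w. dd (\<lambda>q. g q u v) p w = g p (G p w u) v + g p u (G p w v)"
  shows "levi_civita g = christoffel_connection G"
proof -
  have bil: "bilinear (g p)" for p
    using g by (simp add: bilinear_field_def)
  let ?D = "christoffel_connection G"
  have aff: "affine_connection ?D"
    using affine_christoffel_connection[OF G] .
  have tor: "torsion_free ?D"
    unfolding torsion_free_def
  proof (intro ballI)
    fix X Y :: "'n vector_field"
    assume "X \<in> smooth_vfs" "Y \<in> smooth_vfs"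
    then show "(\<lambda>p. ?D X Y p - ?D Y X p) = lie_bracket X Y"
      using G_sym[of _ "X _" "Y _"]
      by (simp add: smooth_vfs_def christoffel_connection_apply lie_bracket_def)
  qed
  have met: "metric_compatible g ?D"
    unfolding metric_compatible_def
  proof (intro ballI ext)
    fix X Y Z :: "'n vector_field" and p
    assume "X \<in> smooth_vfs" "Y \<in> smooth_vfs" "Z \<in> smooth_vfs"
    then have s: "smooth X" "smooth Y" "smooth Z"
      by (simp_all add: smooth_vfs_def)
    show "apply_vf X (\<lambda>p. g p (Y p) (Z p)) p = g p (?D X Y p) (Z p) + g p (Y p) (?D X Z p)"
      unfolding apply_vf_def dd_bilinear_field[OF g s(2,3)] compat
      by (simp add: christoffel_connection_apply s bilinear_ladd[OF bil] bilinear_radd[OF bil])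
  qed
  show ?thesis
    unfolding levi_civita_def
  proof (rule the_equality)
    fix D assume "affine_connection D \<and> torsion_free D \<and> metric_compatible g D"
    then show "D = ?D"
      by (intro levi_civita_unique[of g]) (use g_sym bil nondeg aff tor met in auto)
  qed (use aff tor met in blast)
qed

section \<open>Curvature, Lie derivative and commutators in coordinates\<close>

lemma smooth_lie_bracket: "smooth X \<Longrightarrow> smooth Y \<Longrightarrow> smooth (lie_bracket X Y)"
  unfolding lie_bracket_def by (intro smooth_diff smooth_dd_field)

text \<open>Second derivatives of \<open>Z\<close> cancel by Schwarz, the mixed terms in
  \<open>G\<close> and the derivative of \<open>Z\<close> cancel by symmetry, and the bracket term
  absorbs the derivatives of \<open>X\<close> and \<open>Y\<close>.\<close>

lemma curvature_christoffel:
  assumes lc: "levi_civita g = christoffel_connection G" and G: "bilinear_field G"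
    and X: "smooth X" and Y: "smooth Y" and Z: "smooth Z"
  shows "curvature g X Y Z p =
    dd (\<lambda>q. G q (Y p) (Z p)) p (X p) - dd (\<lambda>q. G q (X p) (Z p)) p (Y p)
    + G p (X p) (G p (Y p) (Z p)) - G p (Y p) (G p (X p) (Z p))"
proof -
  have bil: "bilinear (G p)" for p
    using G by (simp add: bilinear_field_def)
  have D: "dd (\<lambda>p. dd Z p (Y p) + G p (Y p) (Z p)) p h
      = dd (\<lambda>q. dd Z q (Y p)) p h + dd Z p (dd Y p h)
        + (dd (\<lambda>q. G q (Y p) (Z p)) p h + G p (dd Y p h) (Z p) + G p (Y p) (dd Z p h))"
    if "smooth Y" for Y h
    using that Z by (simp add: dd_add smooth_dd_field smooth_bilinear_field[OF G]
        dd_dd_field[OF Z that] dd_bilinear_field[OF G that Z])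
  show ?thesis
    using second_derivative_commute[OF Z, of "Y p" p "X p"]
    by (simp add: curvature_def lc Let_def christoffel_connection_apply smooth_christoffel[OF G]
        smooth_lie_bracket X Y Z D bilinear_radd[OF bil])
      (simp add: lie_bracket_def linear_diff[OF linear_dd[OF Z]] bilinear_lsub[OF bil])
qed

text \<open>The derivatives of \<open>Y\<close> and \<open>Z\<close> cancel against the brackets, so
  only their values at \<open>p\<close> survive.\<close>

lemma lie_derivative_bilinear_field:
  assumes T: "\<And>Y Z. smooth Y \<Longrightarrow> smooth Z \<Longrightarrow> T Y Z = (\<lambda>p. B p (Y p) (Z p))"
    and B: "bilinear_field B" and X: "smooth X" and Y: "smooth Y" and Z: "smooth Z"
  shows "lie_derivative X T Y Z p
    = dd (\<lambda>q. B q (Y p) (Z p)) p (X p) + B p (dd X p (Y p)) (Z p) + B p (Y p) (dd X p (Z p))"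
proof -
  have "bilinear (B p)" for p
    using B by (simp add: bilinear_field_def)
  note lin = bilinear_lsub[OF this] bilinear_rsub[OF this]
  show ?thesis
    unfolding lie_derivative_def apply_vf_def T[OF Y Z] T[OF smooth_lie_bracket[OF X Y] Z]
      T[OF Y smooth_lie_bracket[OF X Z]] dd_bilinear_field[OF B Y Z]
    by (simp add: lie_bracket_def lin)
qed

lemma apply_vf_lie_bracket:
  assumes f: "smooth f" and X: "smooth X" and Y: "smooth Y"
  shows "apply_vf X (apply_vf Y f) p - apply_vf Y (apply_vf X f) p
    = apply_vf (lie_bracket X Y) f p"
  using second_derivative_commute[OF f, of "Y p" p "X p"]
  unfolding apply_vf_def dd_dd_field[OF f X] dd_dd_field[OF f Y]
  by (simp add: lie_bracket_def linear_diff[OF linear_dd[OF f]])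

section \<open>The Ricci tensor of the Heisenberg group\<close>

lemma dd_nth:
  fixes X :: "'a::euclidean_space \<Rightarrow> real^'n"
  assumes "smooth X"
  shows "dd X p h $ i = dd (\<lambda>q. X q $ i) p h"
  using dd_inner_const[OF assms, of "axis i 1"] by (simp add: inner_axis)

text \<open>Metric, Christoffel and Ricci coefficients depend on \<open>x\<close> alone, so their
  derivatives reduce to one-variable calculus.\<close>

lemma has_derivative_coord:
  fixes p :: "real^'n"
  shows "(\<phi> has_real_derivative D) (at (p $ i)) \<Longrightarrow> ((\<lambda>q. \<phi> (q $ i)) has_derivative (\<lambda>h. h $ i * D)) (at p)"
  using has_derivative_compose[of "\<lambda>q. q $ i" "\<lambda>h. h $ i" p UNIV \<phi> "\<lambda>x. x * D",
      OF bounded_linear_imp_has_derivative[OF bounded_linear_vec_nth]]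
  by (simp add: has_field_derivative_def mult_commute_abs)

lemmas dd_coord = has_derivative_coord[THEN dd_eqI]

lemma smooth_heis_frame: "smooth (heis_frame lam i)"
  using heis_frame_smooth by (simp add: smooth_vfs_def)

text \<open>The Christoffel symbols of \<open>heis_g1 lam\<close> in the coordinates \<open>x, y, z\<close>. In the frame they
  amount to \<open>\<nabla>\<^sub>1 e\<^sub>2 = \<nabla>\<^sub>2 e\<^sub>1 = (lam/2) e\<^sub>3\<close>, \<open>\<nabla>\<^sub>1 e\<^sub>3 = \<nabla>\<^sub>3 e\<^sub>1 = (lam/2) e\<^sub>2\<close>,
  \<open>\<nabla>\<^sub>2 e\<^sub>3 = - \<nabla>\<^sub>3 e\<^sub>2 = (lam/2) e\<^sub>1\<close>.\<close>

definition heis_christoffel :: "real \<Rightarrow> real^3 \<Rightarrow> real^3 \<Rightarrow> real^3 \<Rightarrow> real^3" where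
  "heis_christoffel lam p u v = vector
    [lam\<^sup>2 / 2 * ((p$1 * u$2 + u$3) * v$2 + u$2 * (p$1 * v$2 + v$3)),
     ((p$1 * u$2 + u$3) * v$1 + u$1 * (p$1 * v$2 + v$3)) / 2,
     (u$1 * v$2 + u$2 * v$1) / 2
       - p$1 * (((p$1 * u$2 + u$3) * v$1 + u$1 * (p$1 * v$2 + v$3)) / 2)]"

text \<open>The frame components of \<open>u\<close> are \<open>p$1 * u$2 + u$3\<close>,
  \<open>u$2\<close> and \<open>u$1 / lam\<close>; in the last term their \<open>lam\<^sup>2\<close>
  cancels.\<close>

definition heis_ricci :: "real \<Rightarrow> real^3 \<Rightarrow> real^3 \<Rightarrow> real^3 \<Rightarrow> real" where
  "heis_ricci lam p u v = lam\<^sup>2 / 2 * (u$2 * v$2 - (p$1 * u$2 + u$3) * (p$1 * v$2 + v$3))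
     - u$1 * v$1 / 2"

lemma smooth_divide_const:
  fixes f :: "'a::euclidean_space \<Rightarrow> real"
  shows "smooth f \<Longrightarrow> smooth (\<lambda>p. f p / c)"
  using smooth_mult[OF _ smooth_const, of f "inverse c"] by (simp add: divide_inverse)

lemma bilinear_field_heis_g1: "bilinear_field (heis_g1 lam)"
proof -
  have "smooth (\<lambda>p. heis_g1 lam p u v)" for u v
    unfolding heis_g1_def by (intro smooth_add smooth_mult smooth_coord smooth_const)
  then show ?thesis
    unfolding bilinear_field_def bilinear_def
    by (auto intro!: linearI simp: heis_g1_def algebra_simps add_divide_distrib)
qed

lemma bilinear_field_heis_christoffel: "bilinear_field (heis_christoffel lam)"
proof -
  have "smooth (\<lambda>p. heis_christoffel lam p u v $ i)" for u v i
    using exhaust_3[of i] unfolding heis_christoffel_def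
    by (elim disjE) (simp_all, (intro smooth_add smooth_diff smooth_mult smooth_divide_const
        smooth_coord smooth_const)+)
  then show ?thesis
    unfolding bilinear_field_def bilinear_def
    by (auto intro!: linearI smooth_vecI
        simp: heis_christoffel_def vec_eq_iff forall_3 field_simps)
qed

lemma bilinear_field_heis_ricci: "bilinear_field (heis_ricci lam)"
proof -
  have "smooth (\<lambda>p. heis_ricci lam p u v)" for u v
    unfolding heis_ricci_def
    by (intro smooth_add smooth_diff smooth_mult smooth_divide_const smooth_coord smooth_const)
  then show ?thesis
    unfolding bilinear_field_def bilinear_def
    by (auto intro!: linearI simp: heis_ricci_def field_simps)
qed

lemma levi_civita_heis:
  assumes "lam \<noteq> 0"
  shows "levi_civita (heis_g1 lam) = christoffel_connection (heis_christoffel lam)"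
proof (rule levi_civita_christoffel)
  show "u = 0" if "\<forall>v. heis_g1 lam p u v = 0" for p u
    \<comment> \<open>The test vectors are \<open>e_3 / lam\<close>, \<open>e_2\<close> and
      \<open>e_1\<close>; each isolates one frame component of \<open>u\<close>, up to a nonzero
      factor.\<close>
    using that[rule_format, of "vector [1, 0, 0]"] that[rule_format, of "vector [0, 1, - p$1]"]
      that[rule_format, of "vector [0, 0, 1]"]
      assms
    by (simp add: heis_g1_def vec_eq_iff forall_3)
  show "dd (\<lambda>q. heis_g1 lam q u v) p w
     = heis_g1 lam p (heis_christoffel lam p w u) v + heis_g1 lam p u (heis_christoffel lam p w v)"
    for p u v w
  proof -
    have "dd (\<lambda>q. heis_g1 lam q u v) p w
      = w$1 * (u$2 * (p$1 * v$2 + v$3) + (p$1 * u$2 + u$3) * v$2)"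
      unfolding heis_g1_def by (rule dd_coord[THEN fun_cong]) (auto intro!: derivative_eq_intros)
    then show ?thesis
      using assms by (simp add: heis_g1_def heis_christoffel_def field_simps power2_eq_square)
  qed
qed (simp_all add: bilinear_field_heis_g1 bilinear_field_heis_christoffel,
    simp_all add: heis_g1_def heis_christoffel_def vec_eq_iff forall_3 algebra_simps)

lemma dd_heis_christoffel:
  "dd (\<lambda>q. heis_christoffel lam q u v) p w = w$1 *\<^sub>R vector
    [lam\<^sup>2 * (u$2 * v$2), (u$2 * v$1 + u$1 * v$2) / 2,
     - (((p$1 * u$2 + u$3) * v$1 + u$1 * (p$1 * v$2 + v$3)) / 2) - p$1 * ((u$2 * v$1 + u$1 * v$2) / 2)]"
proof -
  have "smooth (\<lambda>q. heis_christoffel lam q u v)"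
    using bilinear_field_heis_christoffel by (simp add: bilinear_field_def)
  note nth = dd_nth[OF this]
  have "dd (\<lambda>q. heis_christoffel lam q u v $ 1) p w = w$1 * (lam\<^sup>2 * (u$2 * v$2))"
    unfolding heis_christoffel_def vector_3
    by (rule dd_coord[THEN fun_cong]) (auto intro!: derivative_eq_intros simp: field_simps)
  moreover have "dd (\<lambda>q. heis_christoffel lam q u v $ 2) p w = w$1 * ((u$2 * v$1 + u$1 * v$2) / 2)"
    unfolding heis_christoffel_def vector_3
    by (rule dd_coord[THEN fun_cong]) (auto intro!: derivative_eq_intros simp: field_simps)
  moreover have "dd (\<lambda>q. heis_christoffel lam q u v $ 3) p w = w$1 *
    (- (((p$1 * u$2 + u$3) * v$1 + u$1 * (p$1 * v$2 + v$3)) / 2) - p$1 * ((u$2 * v$1 + u$1 * v$2) / 2))"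
    unfolding heis_christoffel_def vector_3
    by (rule dd_coord[THEN fun_cong]) (auto intro!: derivative_eq_intros simp: field_simps)
  ultimately show ?thesis
    by (simp add: vec_eq_iff forall_3 nth)
qed

lemma ricci_heis:
  assumes "lam \<noteq> 0" and X: "smooth X" and Y: "smooth Y"
  shows "ricci (heis_g1 lam) (heis_frame lam) X Y = (\<lambda>p. heis_ricci lam p (X p) (Y p))"
proof
  fix p
  note curv = curvature_christoffel[OF levi_civita_heis[OF assms(1)]
      bilinear_field_heis_christoffel smooth_heis_frame X Y, where p = p, unfolded dd_heis_christoffel]
  show "ricci (heis_g1 lam) (heis_frame lam) X Y p = heis_ricci lam p (X p) (Y p)"
    unfolding ricci_def sum_3 heis_frame_orthonormal[OF assms(1)] curv
    using assms(1)
    by (simp add: heis_christoffel_def heis_g1_def heis_frame_def heis_ricci_def)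
      (simp add: field_simps power2_eq_square)
qed

text \<open>The coefficients are the dual coframe \<open>x dy + dz\<close>, \<open>dy\<close>,
  \<open>dx / lam\<close> at \<open>p\<close>.\<close>

lemma linear_heis_frame:
  assumes "linear L" "lam \<noteq> 0"
  shows "L u = (p$1 * u$2 + u$3) *\<^sub>R L (heis_frame lam 1 p) + u$2 *\<^sub>R L (heis_frame lam 2 p)
    + (u$1 / lam) *\<^sub>R L (heis_frame lam 3 p)"
proof -
  have "u = (p$1 * u$2 + u$3) *\<^sub>R heis_frame lam 1 p + u$2 *\<^sub>R heis_frame lam 2 p
    + (u$1 / lam) *\<^sub>R heis_frame lam 3 p"
    using assms(2) by (simp add: heis_frame_def vec_eq_iff forall_3)
  then have "L u = L \<dots>" by simp
  then show ?thesis
    by (simp only: linear_add[OF assms(1)] linear_scale[OF assms(1)])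
qed

section \<open>Ricci collineations\<close>

abbreviation frame_deriv :: "real \<Rightarrow> 3 \<Rightarrow> (real^3 \<Rightarrow> real) \<Rightarrow> real^3 \<Rightarrow> real" where
  "frame_deriv lam i \<equiv> apply_vf (heis_frame lam i)"

text \<open>The six equations are the components (1,1), (2,2), (3,3), (1,2), (1,3), (2,3) of the Lie
  derivative of the Ricci tensor in the frame, up to nonzero factors.\<close>

definition collineation_system ::
    "real \<Rightarrow> (real^3 \<Rightarrow> real) \<Rightarrow> (real^3 \<Rightarrow> real) \<Rightarrow> (real^3 \<Rightarrow> real) \<Rightarrow> bool" where
  "collineation_system lam f1 f2 f3 \<longleftrightarrow> (\<forall>p.
     frame_deriv lam 1 f1 p = 0 \<and> frame_deriv lam 2 f2 p = 0 \<and> frame_deriv lam 3 f3 p = 0 \<and>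
     frame_deriv lam 2 f1 p = frame_deriv lam 1 f2 p - lam * f3 p \<and>
     frame_deriv lam 3 f1 p = lam * f2 p - frame_deriv lam 1 f3 p \<and>
     frame_deriv lam 3 f2 p = frame_deriv lam 2 f3 p)"

text \<open>Here \<open>a, b, c\<close> and \<open>a', b', c'\<close> are the frame components of
  \<open>Y\<close> and \<open>Z\<close>. The undifferentiated terms in \<open>f2\<close> and
  \<open>f3\<close> reflect \<open>[e_2, e_3] = lam e_1\<close>.\<close>

lemma lie_derivative_heis_ricci:
  fixes lam f1 f2 f3
  defines "X \<equiv> \<lambda>p. f1 p *\<^sub>R heis_frame lam 1 p + f2 p *\<^sub>R heis_frame lam 2 p + f3 p *\<^sub>R heis_frame lam 3 p"
  assumes lam: "lam \<noteq> 0" and f: "smooth f1" "smooth f2" "smooth f3"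
    and Y: "smooth Y" and Z: "smooth Z"
  shows "lie_derivative X (ricci (heis_g1 lam) (heis_frame lam)) Y Z p = lam\<^sup>2 / 2 *
    (let a = p$1 * Y p$2 + Y p$3; b = Y p$2; c = Y p$1 / lam;
         a' = p$1 * Z p$2 + Z p$3; b' = Z p$2; c' = Z p$1 / lam
     in - 2 * a * a' * frame_deriv lam 1 f1 p + 2 * b * b' * frame_deriv lam 2 f2 p
        - 2 * c * c' * frame_deriv lam 3 f3 p
        + (a * b' + b * a') * (frame_deriv lam 1 f2 p - lam * f3 p - frame_deriv lam 2 f1 p)
        + (a * c' + c * a') * (lam * f2 p - frame_deriv lam 1 f3 p - frame_deriv lam 3 f1 p)
        + (b * c' + c * b') * (frame_deriv lam 3 f2 p - frame_deriv lam 2 f3 p))"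
proof -
  have X: "smooth X"
    unfolding X_def by (intro smooth_add smooth_scaleR f smooth_heis_frame)
  have nth: "X q $ 1 = lam * f3 q" "X q $ 2 = f2 q" "X q $ 3 = f1 q - q$1 * f2 q" for q
    by (simp_all add: X_def heis_frame_def)
  have d1: "dd X p h $ 1 = lam * dd f3 p h" for h
    unfolding dd_nth[OF X] nth
    by (rule dd_eqI[THEN fun_cong]) (auto intro!: derivative_eq_intros smooth_has_derivative f)
  have d2: "dd X p h $ 2 = dd f2 p h" for h
    unfolding dd_nth[OF X] nth by simp
  have d3: "dd X p h $ 3 = dd f1 p h - (h$1 * f2 p + p$1 * dd f2 p h)" for h
    unfolding dd_nth[OF X] nth
    by (rule dd_eqI[THEN fun_cong]) (auto intro!: derivative_eq_intros smooth_has_derivative f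
        bounded_linear.has_derivative[OF bounded_linear_vec_nth])
  have R: "dd (\<lambda>q. heis_ricci lam q u v) p w
      = - (w$1 * (lam\<^sup>2 / 2 * (u$2 * (p$1 * v$2 + v$3) + (p$1 * u$2 + u$3) * v$2)))" for u v w
    unfolding heis_ricci_def minus_mult_right
    by (rule dd_coord[THEN fun_cong]) (auto intro!: derivative_eq_intros simp: field_simps)
  have frame: "dd f p u = (p$1 * u$2 + u$3) * frame_deriv lam 1 f p + u$2 * frame_deriv lam 2 f p
      + u$1 / lam * frame_deriv lam 3 f p" if "smooth f" for f :: "real^3 \<Rightarrow> real" and u
    using linear_heis_frame[OF linear_dd[OF that] lam] by (simp add: apply_vf_def)
  \<comment> \<open>Writing the first coordinates as multiples of \<open>lam\<close> clears the
    divisions before expanding.\<close>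
  obtain c c' where c: "Y p $ 1 = lam * c" and c': "Z p $ 1 = lam * c'"
    using lam by (metis dvd_def dvd_field_iff)
  have lie: "lie_derivative X (ricci (heis_g1 lam) (heis_frame lam)) Y Z p
      = dd (\<lambda>q. heis_ricci lam q (Y p) (Z p)) p (X p)
        + heis_ricci lam p (dd X p (Y p)) (Z p) + heis_ricci lam p (Y p) (dd X p (Z p))"
    by (rule lie_derivative_bilinear_field[OF _ bilinear_field_heis_ricci X Y Z])
      (rule ricci_heis[OF lam])
  show ?thesis
    unfolding lie R
    unfolding heis_ricci_def d1 d2 d3 nth f[THEN frame] Let_def
    unfolding c c'
    using lam by (simp add: algebra_simps power2_eq_square add_divide_distrib diff_divide_distrib)
qed

text \<open>Pairs of frame fields isolate the six coefficients of the Lie derivative; conversely,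
  their vanishing kills it on all smooth fields.\<close>

lemma ricci_collineation_heis_iff:
  assumes lam: "lam \<noteq> 0" and f: "smooth f1" "smooth f2" "smooth f3"
  shows "ricci_collineation (heis_g1 lam) (heis_frame lam)
      (\<lambda>p. f1 p *\<^sub>R heis_frame lam 1 p + f2 p *\<^sub>R heis_frame lam 2 p + f3 p *\<^sub>R heis_frame lam 3 p)
    \<longleftrightarrow> collineation_system lam f1 f2 f3" (is "ricci_collineation ?g ?e ?X \<longleftrightarrow> _")
proof
  assume rc: "ricci_collineation ?g ?e ?X"
  show "collineation_system lam f1 f2 f3"
    unfolding collineation_system_def
  proof (rule allI)
    fix p
    have "lie_derivative ?X (ricci ?g ?e) (?e i) (?e j) = (\<lambda>p. 0)" for i j
      using rc heis_frame_smooth unfolding ricci_collineation_def by blast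
    then have eq: "lie_derivative ?X (ricci ?g ?e) (?e i) (?e j) p = 0" for i j
      by simp
    note eq = eq[unfolded lie_derivative_heis_ricci[OF lam f smooth_heis_frame smooth_heis_frame]]
    have nth: "?e 1 p $ 1 = 0" "?e 1 p $ 2 = 0" "?e 1 p $ 3 = 1" "?e 2 p $ 1 = 0" "?e 2 p $ 2 = 1"
      "?e 2 p $ 3 = - p $ 1" "?e 3 p $ 1 = lam" "?e 3 p $ 2 = 0" "?e 3 p $ 3 = 0"
      by (simp_all add: heis_frame_def)
    show "frame_deriv lam 1 f1 p = 0 \<and> frame_deriv lam 2 f2 p = 0 \<and> frame_deriv lam 3 f3 p = 0 \<and>
     frame_deriv lam 2 f1 p = frame_deriv lam 1 f2 p - lam * f3 p \<and>
     frame_deriv lam 3 f1 p = lam * f2 p - frame_deriv lam 1 f3 p \<and>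
     frame_deriv lam 3 f2 p = frame_deriv lam 2 f3 p"
      using eq[where i = 1 and j = 1] eq[where i = 2 and j = 2] eq[where i = 3 and j = 3]
        eq[where i = 1 and j = 2] eq[where i = 1 and j = 3] eq[where i = 2 and j = 3] lam
      by (simp add: Let_def nth)
  qed
next
  assume "collineation_system lam f1 f2 f3"
  then have "lie_derivative ?X (ricci ?g ?e) Y Z p = 0" if "smooth Y" "smooth Z" for Y Z p
    unfolding lie_derivative_heis_ricci[OF lam f that] collineation_system_def
    by (simp add: Let_def)
  moreover have "?X \<in> smooth_vfs"
    unfolding smooth_vfs_def mem_Collect_eq
    by (intro smooth_add smooth_scaleR f smooth_heis_frame)
  ultimately show "ricci_collineation ?g ?e ?X"
    unfolding ricci_collineation_def
    by (simp add: smooth_vfs_def fun_eq_iff)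
qed

section \<open>Frame derivatives and their commutators\<close>

lemma smooth_apply_vf: "smooth X \<Longrightarrow> smooth f \<Longrightarrow> smooth (apply_vf X f)"
  unfolding apply_vf_def by (rule smooth_dd_field)

lemma apply_vf_lincomb:
  assumes "smooth f" "smooth g"
  shows "apply_vf X (\<lambda>p. a * f p + b * g p) = (\<lambda>p. a * apply_vf X f p + b * apply_vf X g p)"
  unfolding apply_vf_def
  by (rule ext, rule dd_eqI[THEN fun_cong])
    (auto intro!: derivative_eq_intros smooth_has_derivative assms)

lemma apply_vf_zero [simp]: "apply_vf X (\<lambda>p. 0) = (\<lambda>p. 0)"
  by (simp add: apply_vf_def)

lemma dd_heis_frame: "dd (heis_frame lam i) p h = (if i = 2 then vector [0, 0, - h$1] else 0)"
proof -
  have "dd (\<lambda>p. - p $ 1) p h = - h $ 1" for p :: "real^3"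
    by (intro dd_eqI[THEN fun_cong] has_derivative_minus bounded_linear_imp_has_derivative
        bounded_linear_vec_nth)
  then have "dd (\<lambda>p. heis_frame lam i p $ j) p h = (if i = 2 \<and> j = 3 then - h$1 else 0)" for j
    using exhaust_3[of i] exhaust_3[of j] by (elim disjE) (simp_all add: heis_frame_def)
  then show ?thesis
    by (simp add: vec_eq_iff forall_3 dd_nth[OF smooth_heis_frame])
qed

text \<open>\<open>e_1\<close> is central in the Heisenberg algebra, and the remaining bracket is
  \<open>[e_2, e_3] = lam e_1\<close>.\<close>

lemma heis_frame_commute:
  assumes f: "smooth f"
  shows "frame_deriv lam 1 (frame_deriv lam i f) p = frame_deriv lam i (frame_deriv lam 1 f) p"
    and "frame_deriv lam 2 (frame_deriv lam 3 f) p - frame_deriv lam 3 (frame_deriv lam 2 f) p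
      = lam * frame_deriv lam 1 f p"
proof -
  have "lie_bracket (heis_frame lam 1) (heis_frame lam i) = (\<lambda>p. 0)"
    by (auto simp: lie_bracket_def dd_heis_frame fun_eq_iff vec_eq_iff forall_3)
      (simp_all add: heis_frame_def)
  then show "frame_deriv lam 1 (frame_deriv lam i f) p = frame_deriv lam i (frame_deriv lam 1 f) p"
    using apply_vf_lie_bracket[OF f smooth_heis_frame smooth_heis_frame, of lam 1 lam i p]
    by (simp add: apply_vf_def linear_0[OF linear_dd[OF f]])
  have "lie_bracket (heis_frame lam 2) (heis_frame lam 3) = (\<lambda>p. lam *\<^sub>R heis_frame lam 1 p)"
    by (simp add: lie_bracket_def dd_heis_frame)
      (simp add: heis_frame_def fun_eq_iff vec_eq_iff forall_3)
  then show "frame_deriv lam 2 (frame_deriv lam 3 f) p - frame_deriv lam 3 (frame_deriv lam 2 f) p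
      = lam * frame_deriv lam 1 f p"
    using apply_vf_lie_bracket[OF f smooth_heis_frame smooth_heis_frame, of lam 2 lam 3 p]
    by (simp add: apply_vf_def linear_scale[OF linear_dd[OF f]])
qed

text \<open>The frame spans each tangent space, so \<open>f - P\<close> has zero derivative and is
  constant.\<close>

lemma eq_if_frame_deriv_eq:
  fixes f P :: "real^3 \<Rightarrow> real"
  assumes lam: "lam \<noteq> 0" and f: "smooth f" and P: "smooth P"
    and eq: "\<And>i p. frame_deriv lam i f p = frame_deriv lam i P p" and "f 0 = P 0"
  shows "f p = P p"
proof -
  have "dd f q h = dd P q h" for q h
    using linear_heis_frame[OF linear_dd[OF f] lam, of q h q]
      linear_heis_frame[OF linear_dd[OF P] lam, of q h q] eq[of _ q]
    by (simp add: apply_vf_def)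
  then have "((\<lambda>p. f p - P p) has_derivative (\<lambda>h. 0)) (at q)" for q
    using has_derivative_diff[OF smooth_has_derivative[OF f] smooth_has_derivative[OF P], of q]
    by simp
  then have "f p - P p = f 0 - P 0"
    by (intro has_derivative_zero_unique[of UNIV "\<lambda>p. f p - P p"]) auto
  then show ?thesis using assms(5) by simp
qed

text \<open>Common shape of all three solution components, so that one derivative computation serves
  them all.\<close>

definition quad :: "real \<Rightarrow> real \<Rightarrow> real \<Rightarrow> real \<Rightarrow> real \<Rightarrow> real^3 \<Rightarrow> real" where
  "quad a b c d e p = a * (p$1)\<^sup>2 + b * (p$2)\<^sup>2 + c * p$1 + d * p$2 + e"

lemma smooth_quad: "smooth (quad a b c d e)"
  unfolding quad_def[abs_def] power2_eq_square
  by (intro smooth_add smooth_mult smooth_coord smooth_const)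

lemma frame_deriv_quad:
  "frame_deriv lam 1 (quad a b c d e) p = 0"
  "frame_deriv lam 2 (quad a b c d e) p = 2 * b * p$2 + d"
  "frame_deriv lam 3 (quad a b c d e) p = lam * (2 * a * p$1 + c)"
proof -
  have "dd (quad a b c d e) p h = (2 * a * p$1 + c) * h$1 + (2 * b * p$2 + d) * h$2" for h
    unfolding quad_def[abs_def]
    by (rule dd_eqI[THEN fun_cong]) (auto intro!: derivative_eq_intros
        bounded_linear.has_derivative[OF bounded_linear_vec_nth] simp: algebra_simps)
  then show "frame_deriv lam 1 (quad a b c d e) p = 0"
    "frame_deriv lam 2 (quad a b c d e) p = 2 * b * p$2 + d"
    "frame_deriv lam 3 (quad a b c d e) p = lam * (2 * a * p$1 + c)"
    by (simp_all add: apply_vf_def heis_frame_def)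
qed

lemma collineation_system_solution:
  assumes lam: "lam \<noteq> 0" and f: "smooth f1" "smooth f2" "smooth f3"
    and sys: "collineation_system lam f1 f2 f3"
  obtains c1 c2 c3 c4 where
    "f1 = quad (c1 / (2 * lam)) (- (lam * c1 / 2)) c2 (- (lam * c3)) c4"
    "f2 = quad 0 0 (c1 / lam) 0 c2" "f3 = quad 0 0 0 c1 c3"
proof -
  let ?E = "frame_deriv lam"
  have E: "smooth (?E i f)" if "smooth f" for i f
    using smooth_apply_vf[OF smooth_heis_frame that] .
  define u v where "u = ?E 1 f2" and "v = ?E 1 f3"
  have uv: "smooth u" "smooth v"
    unfolding u_def v_def by (intro E f)+
  \<comment> \<open>The explicit coefficients \<open>1\<close> and \<open>- 1\<close> fit the
    pattern of \<open>apply_vf_lincomb\<close>.\<close>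
  have s: "?E 1 f1 = (\<lambda>p. 0)" "?E 2 f2 = (\<lambda>p. 0)" "?E 3 f3 = (\<lambda>p. 0)"
    "?E 2 f1 = (\<lambda>p. 1 * u p + (- lam) * f3 p)" "?E 3 f1 = (\<lambda>p. lam * f2 p + (- 1) * v p)"
    "?E 3 f2 = ?E 2 f3"
    using sys unfolding collineation_system_def u_def v_def by (auto simp: fun_eq_iff)
  have u1: "?E 1 u p = lam * v p" for p
    using heis_frame_commute(1)[OF f(1), of lam 2 p]
    unfolding s apply_vf_lincomb[OF uv(1) f(3)] by (simp add: v_def)
  have v1: "?E 1 v p = lam * u p" for p
    using heis_frame_commute(1)[OF f(1), of lam 3 p]
    unfolding s apply_vf_lincomb[OF f(2) uv(2)] by (simp add: u_def)
  have u2: "?E 2 u = (\<lambda>p. 0)"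
    using heis_frame_commute(1)[OF f(2), of lam 2] unfolding s by (auto simp: u_def)
  have v3: "?E 3 v = (\<lambda>p. 0)"
    using heis_frame_commute(1)[OF f(3), of lam 3] unfolding s by (auto simp: v_def)
  \<comment> \<open>Both sides are \<open>E_1\<close> applied to
    \<open>E_2 f3 = E_3 f2\<close>.\<close>
  have A: "?E 2 v p = ?E 3 u p" for p
    using heis_frame_commute(1)[OF f(2), of lam 3 p] heis_frame_commute(1)[OF f(3), of lam 2 p]
    unfolding s by (simp add: u_def v_def)
  \<comment> \<open>This is \<open>[E_2, E_3] f1 = lam E_1 f1 = 0\<close> with the formulas for
    \<open>E_2 f1\<close> and \<open>E_3 f1\<close> inserted.\<close>
  have B: "?E 2 v p + ?E 3 u p = 0" for p
    using heis_frame_commute(2)[OF f(1), of lam p]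
    unfolding s apply_vf_lincomb[OF uv(1) f(3)] apply_vf_lincomb[OF f(2) uv(2)] by (simp add: s)
  have u3: "?E 3 u = (\<lambda>p. 0)" and v2: "?E 2 v = (\<lambda>p. 0)"
    using A B by (auto simp: fun_eq_iff)
  have "?E 1 u p = 0" "?E 1 v p = 0" for p
    using heis_frame_commute(2)[OF uv(1), of lam p] heis_frame_commute(2)[OF uv(2), of lam p] lam
    by (simp_all add: u2 u3 v2 v3)
  then have u: "u = (\<lambda>p. 0)" and v: "v = (\<lambda>p. 0)"
    using u1 v1 lam by (auto simp: fun_eq_iff)
  define k where "k = ?E 2 f3"
  have k: "smooth k"
    unfolding k_def by (intro E f)
  \<comment> \<open>\<open>E_1 k = E_2 v\<close>; for \<open>E_2 k\<close> and \<open>E_3 k\<close>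
    use \<open>[E_2, E_3]\<close> on \<open>f2\<close> and \<open>f3\<close>, which gives multiples
    of \<open>u\<close> and \<open>v\<close>.\<close>
  have k_deriv: "?E i k p = 0" for i p
  proof -
    have "?E 1 k p = 0"
      using heis_frame_commute(1)[OF f(3), of lam 2 p] v by (simp add: k_def v_def)
    moreover have "?E 2 k p = 0"
      using heis_frame_commute(2)[OF f(2), of lam p] u by (simp add: k_def u_def s)
    moreover have "?E 3 k p = 0"
      using heis_frame_commute(2)[OF f(3), of lam p] v by (simp add: k_def v_def s)
    ultimately show ?thesis
      using exhaust_3[of i] by auto
  qed
  define c1 c2 c3 where "c1 = k 0" and "c2 = f2 0" and "c3 = f3 0"
  have "k p = c1" for p
  proof (rule eq_if_frame_deriv_eq[OF lam k smooth_const])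
    show "?E i k p = ?E i (\<lambda>p. c1) p" for i p
      unfolding k_deriv by (simp add: apply_vf_def)
  qed (rule c1_def[symmetric])
  then have k_eq: "?E 2 f3 = (\<lambda>p. c1)"
    by (simp add: k_def fun_eq_iff)
  have f2: "f2 = quad 0 0 (c1 / lam) 0 c2"
  proof
    show "f2 p = quad 0 0 (c1 / lam) 0 c2 p" for p
    proof (rule eq_if_frame_deriv_eq[OF lam f(2) smooth_quad])
      show "?E i f2 p = ?E i (quad 0 0 (c1 / lam) 0 c2) p" for i p
        using exhaust_3[of i] s u k_eq lam by (auto simp: frame_deriv_quad u_def[symmetric])
    qed (simp add: quad_def c2_def)
  qed
  have f3: "f3 = quad 0 0 0 c1 c3"
  proof
    show "f3 p = quad 0 0 0 c1 c3 p" for p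
    proof (rule eq_if_frame_deriv_eq[OF lam f(3) smooth_quad])
      show "?E i f3 p = ?E i (quad 0 0 0 c1 c3) p" for i p
        using exhaust_3[of i] s v k_eq lam by (auto simp: frame_deriv_quad v_def[symmetric])
    qed (simp add: quad_def c3_def)
  qed
  \<comment> \<open>Comes last, because the frame derivatives of \<open>f1\<close> involve the
    solved \<open>f2\<close> and \<open>f3\<close>; \<open>c4\<close> is
    \<open>f1 0\<close>.\<close>
  have f1: "f1 = quad (c1 / (2 * lam)) (- (lam * c1 / 2)) c2 (- (lam * c3)) (f1 0)" (is "_ = ?q")
  proof
    show "f1 p = ?q p" for p
    proof (rule eq_if_frame_deriv_eq[OF lam f(1) smooth_quad])
      show "?E i f1 p = ?E i ?q p" for i p
        using exhaust_3[of i] s(1,4,5) u v lam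
        by (auto simp: frame_deriv_quad) (simp_all add: f2 f3 quad_def field_simps)
    qed (simp add: quad_def)
  qed
  show thesis
    using that f1 f2 f3 by blast
qed

lemma collineation_system_quad:
  assumes "lam \<noteq> 0"
  shows "collineation_system lam (quad (c1 / (2 * lam)) (- (lam * c1 / 2)) c2 (- (lam * c3)) c4)
    (quad 0 0 (c1 / lam) 0 c2) (quad 0 0 0 c1 c3)"
  using assms unfolding collineation_system_def frame_deriv_quad
  by (simp add: quad_def field_simps)

theorem theorem4p1:
  fixes lam :: real and f1 f2 f3 :: "real^3 \<Rightarrow> real"
  assumes "lam \<noteq> 0"
    and "smooth f1" and "smooth f2" and "smooth f3"
  shows "ricci_collineation (heis_g1 lam) (heis_frame lam)
      (\<lambda>p. f1 p *\<^sub>R heis_frame lam 1 p + f2 p *\<^sub>R heis_frame lam 2 p + f3 p *\<^sub>R heis_frame lam 3 p)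
    \<longleftrightarrow> (\<exists>c1 c2 c3 c4 :: real. \<forall>x y z :: real.
      f1 (vector [x, y, z]) =
        c1 / (2 * lam) * x\<^sup>2 - lam * c1 / 2 * y\<^sup>2 + c2 * x - lam * c3 * y + c4 \<and>
      f2 (vector [x, y, z]) = c1 / lam * x + c2 \<and>
      f3 (vector [x, y, z]) = c1 * y + c3)" (is "_ \<longleftrightarrow> ?sol")
proof -
  have "collineation_system lam f1 f2 f3 \<longleftrightarrow> ?sol"
  proof
    assume "collineation_system lam f1 f2 f3"
    then obtain c1 c2 c3 c4 where
      "f1 = quad (c1 / (2 * lam)) (- (lam * c1 / 2)) c2 (- (lam * c3)) c4"
      "f2 = quad 0 0 (c1 / lam) 0 c2" "f3 = quad 0 0 0 c1 c3"
      using collineation_system_solution assms by blast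
    then show ?sol
      by (intro exI[of _ c1] exI[of _ c2] exI[of _ c3] exI[of _ c4]) (simp add: quad_def)
  next
    assume ?sol
    then obtain c1 c2 c3 c4 where c: "\<And>x y z. f1 (vector [x, y, z]) =
        c1 / (2 * lam) * x\<^sup>2 - lam * c1 / 2 * y\<^sup>2 + c2 * x - lam * c3 * y + c4"
      "\<And>x y z. f2 (vector [x, y, z]) = c1 / lam * x + c2"
      "\<And>x y z. f3 (vector [x, y, z]) = c1 * y + c3"
      by blast
    have "vector [p$1, p$2, p$3] = p" for p :: "real^3"
      by (simp add: vec_eq_iff forall_3)
    then have "f1 p = quad (c1 / (2 * lam)) (- (lam * c1 / 2)) c2 (- (lam * c3)) c4 p"
      "f2 p = quad 0 0 (c1 / lam) 0 c2 p" "f3 p = quad 0 0 0 c1 c3 p" for p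
      using c[of "p$1" "p$2" "p$3"] by (simp_all add: quad_def)
    then have "f1 = quad (c1 / (2 * lam)) (- (lam * c1 / 2)) c2 (- (lam * c3)) c4"
      "f2 = quad 0 0 (c1 / lam) 0 c2" "f3 = quad 0 0 0 c1 c3"
      by auto
    then show "collineation_system lam f1 f2 f3"
      using collineation_system_quad[OF assms(1)] by simp
  qed
  then show ?thesis
    using ricci_collineation_heis_iff[OF assms] by blast
qed

end
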